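(* Let $\nu>-1$ and $q\in(0,1)$ be real numbers, let $h_{\nu}^{(2)}(\cdot;q):\mathcal{U}\to\mathbb{C}$ be the normalized Jackson second $q$-Bessel function $h_{\nu}^{(2)}(z;q)=\sum_{n\ge 0}K_n z^{n+1}$, and for each positive integer $m$ let $(h_{\nu}^{(2)})_{m}(z;q)=z+\sum_{n=1}^{m}K_{n}z^{n+1}$ be its partial sum. If $2(1-q)(1-q^{\nu})\geq q^{\nu}$, then for all $z\in\mathcal{U}$ and all positive integers $m$: $$\Re\left\{\frac{h_{\nu}^{(2)}(z;q)}{(h_{\nu}^{(2)})_{m}(z;q)}\right\}\geq\frac{4(1-q)(1-q^{\nu})-2q^{\nu}}{4(1-q)(1-q^{\nu})-q^{\nu}},$$ $$\Re\left\{\frac{(h_{\nu}^{(2)})_{m}(z;q)}{h_{\nu}^{(2)}(z;q)}\right\}\geq\frac{4(1-q)(1-q^{\nu})-q^{\nu}}{4(1-q)(1-q^{\nu})}.$$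
   Context: $\mathcal{U}=\{z\in\mathbb{C}:|z|<1\}$. The $q$-shifted factorials are $(a;q)_0=1$, $(a;q)_n=\prod_{k=1}^{n}(1-aq^{k-1})$, $(a;q)_\infty=\prod_{k\ge1}(1-aq^{k-1})$. Jackson's second $q$-Bessel function is $$J_{\nu}^{(2)}(z;q)=\frac{(q^{\nu+1};q)_{\infty}}{(q;q)_{\infty}}\sum_{n\geq0}\frac{(-1)^{n}(z/2)^{2n+\nu}}{(q;q)_{n}(q^{\nu+1};q)_{n}}q^{n(n+\nu)},$$ and its normalized form is $$h_{\nu}^{(2)}(z;q)=2^{\nu}c_{\nu}(q)z^{1-\frac{\nu}{2}}J_{\nu}^{(2)}(\sqrt{z};q)=\sum_{n\geq0}K_{n}z^{n+1},\qquad K_{n}=\frac{(-1)^nq^{n(n+\nu)}}{4^n(q;q)_{n}(q^{\nu+1};q)_{n}},$$ where $c_{\nu}(q)=(q;q)_{\infty}/(q^{\nu+1};q)_{\infty}$; the power series (with $K_0=1$) is taken as the definition of $h_\nu^{(2)}(\cdot;q)$ on $\mathcal{U}$. At $z=0$, where numerator and denominator both vanish to first order, each quotient is understood as its analytic continuation (i.e. common factors $z$ are cancelled, giving the value $1$). *)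

theory Defs
  imports "HOL-Analysis.Analysis"
begin

definition q_pochhammer :: "real \<Rightarrow> real \<Rightarrow> nat \<Rightarrow> real" where
  "q_pochhammer a q n = (\<Prod>k=1..n. 1 - a * q ^ (k - 1))"

definition bessel_coeff :: "real \<Rightarrow> real \<Rightarrow> nat \<Rightarrow> real" where
  "bessel_coeff \<nu> q n =
     (-1) ^ n * q powr (real n * (real n + \<nu>)) /
     (4 ^ n * q_pochhammer q q n * q_pochhammer (q powr (\<nu> + 1)) q n)"

text \<open>
  The normalized Jackson second \<open>q\<close>-Bessel function
  \<open>2\<^sup>\<nu> c\<^sub>\<nu>(q) z\<^bsup>1 - \<nu>/2\<^esup> J\<^sub>\<nu>(\<surd>z; q)\<close>, with
  \<open>c\<^sub>\<nu>(q) = (q; q)\<^sub>\<infinity> / (q\<^bsup>\<nu>+1\<^esup>; q)\<^sub>\<infinity>\<close>.  It is defined by its power series, so that no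
  branches of the powers have to be chosen.
\<close>

definition normalized_bessel :: "real \<Rightarrow> real \<Rightarrow> complex \<Rightarrow> complex" where
  "normalized_bessel \<nu> q z = (\<Sum>n. of_real (bessel_coeff \<nu> q n) * z ^ (n + 1))"

definition normalized_bessel_partial :: "real \<Rightarrow> real \<Rightarrow> nat \<Rightarrow> complex \<Rightarrow> complex" where
  "normalized_bessel_partial \<nu> q m z =
     z + (\<Sum>n=1..m. of_real (bessel_coeff \<nu> q n) * z ^ (n + 1))"

text \<open>
  The pointwise quotient of two functions, continued to the origin by its limit there.  Away from
  the origin it is plain division; since \<open>x / 0 = 0\<close>, a positive lower bound on its real part
  entails that numerator and denominator do not vanish at that point.
\<close>

definition quotient_ext :: "(complex \<Rightarrow> complex) \<Rightarrow> (complex \<Rightarrow> complex) \<Rightarrow> complex \<Rightarrow> complex" where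
  "quotient_ext f g z = (if z = 0 then Lim (at 0) (\<lambda>w. f w / g w) else f z / g z)"

end

theory Submission
  imports Defs
begin

text \<open>
  Write \<open>h(z) = z (P(z) + T(z))\<close>, where \<open>z P(z)\<close> is the partial sum and \<open>z T(z)\<close> the tail, and put
  \<open>u = T/P\<close>. The two quotients are \<open>1 + u\<close> and \<open>1 / (1 + u)\<close>. As soon as \<open>\<bar>u\<bar> \<le> s \<le> 1\<close>, their real
  parts are at least \<open>1 - s\<close> and \<open>1 / (1 + s)\<close>; for the second, \<open>u \<mapsto> 1 / (1 + u)\<close> maps the disc
  \<open>\<bar>u\<bar> \<le> s\<close>, without \<open>u = -1\<close>, into the half-plane \<open>Re \<ge> 1 / (1 + s)\<close>.

  The bound on \<open>u\<close> holds for every power series with leading coefficient one whose other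
  coefficients have absolute sum at most \<open>s\<close>. Such a series satisfies \<open>\<bar>P - 1\<bar> + \<bar>T\<bar> \<le> s \<bar>z\<bar>\<close>, hence
  \<open>\<bar>T\<bar> \<le> s - \<bar>P - 1\<bar> \<le> s (1 - \<bar>P - 1\<bar>) \<le> s \<bar>P\<bar>\<close>; and
  since \<open>s \<bar>z\<bar> < 1\<close>, neither \<open>P\<close> nor \<open>P + T\<close> vanishes in the unit disc, so that the divisions are
  genuine (\<open>re_quotients_with_partial_sum\<close>).

  For the Bessel function, consecutive coefficients have a ratio of absolute value at most
  \<open>r = q\<^sup>\<nu> / (4 (1 - q) (1 - q\<^sup>\<nu>))\<close> (\<open>bessel_coeff_ratio\<close>). The hypothesis forces
  \<open>q\<^sup>\<nu> < 1\<close> and then says exactly \<open>r \<le> 1/2\<close>. The geometric series gives \<open>s = r / (1 - r) \<le> 1\<close>; then \<open>1 - s\<close> and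
  \<open>1 / (1 + s) = 1 - r\<close> are the two constants.
\<close>

section \<open>Real parts of quotients near one\<close>

lemma norm_quotient_le_of_perturbation:
  fixes P T :: complex
  assumes "norm (P - 1) + norm T \<le> s" and "s \<le> 1" and "P \<noteq> 0"
  shows "norm (T / P) \<le> s"
proof -
  have s0: "0 \<le> s"
    using assms(1) norm_ge_zero[of "P - 1"] norm_ge_zero[of T] by linarith
  have "norm T \<le> s - norm (P - 1)"
    using assms(1) by simp
  also have "\<dots> \<le> s * (1 - norm (P - 1))"
    using mult_right_mono[OF assms(2) norm_ge_zero[of "P - 1"]] by (simp add: algebra_simps)
  also have "\<dots> \<le> s * norm P"
    using norm_triangle_ineq2[of 1 "1 - P"] s0
    by (intro mult_left_mono) (simp_all add: norm_minus_commute)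
  finally show ?thesis
    using assms(3) by (simp add: norm_divide divide_le_eq)
qed

text \<open>
  A point \<open>w \<noteq> 0\<close> has \<open>Re (1 / w) \<ge> 1 / (1 + s)\<close> precisely when it lies in the closed disc with
  diameter \<open>[0, 1 + s]\<close>, that is, when \<open>\<bar>w\<bar>\<^sup>2 \<le> (1 + s) Re w\<close>. For
  \<open>s \<le> 1\<close> this disc contains the one of radius \<open>s\<close> around \<open>1\<close>: both touch the line \<open>Re w = 1 + s\<close> at
  the same point from the left, and the latter is the smaller.
\<close>

lemma Re_inverse_one_plus_ge:
  fixes u :: complex
  assumes "norm u \<le> s" and "s \<le> 1" and "1 + u \<noteq> 0"
  shows "1 / (1 + s) \<le> Re (1 / (1 + u))"
proof -
  have s0: "0 \<le> s"
    using assms(1) norm_ge_zero[of u] by linarith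
  have "(norm u)\<^sup>2 \<le> s\<^sup>2"
    using assms(1) by (intro power_mono) auto
  moreover have "(1 - s) * Re u \<le> (1 - s) * s"
    using assms complex_Re_le_cmod[of u] by (intro mult_left_mono) auto
  moreover have "(norm (1 + u))\<^sup>2 = 1 + 2 * Re u + (norm u)\<^sup>2"
    unfolding cmod_power2 by (simp add: power2_eq_square algebra_simps)
  ultimately have "(norm (1 + u))\<^sup>2 \<le> (1 + s) * Re (1 + u)"
    by (simp add: power2_eq_square algebra_simps)
  then have "1 / (1 + s) \<le> Re (1 + u) / (norm (1 + u))\<^sup>2"
    using s0 assms(3) by (simp add: pos_divide_le_eq pos_le_divide_eq mult.commute del: plus_complex.sel)
  moreover have "Re (1 / (1 + u)) = Re (1 + u) / (norm (1 + u))\<^sup>2"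
    by (simp add: Re_divide cmod_power2)
  ultimately show ?thesis
    by simp
qed

section \<open>Power series and their partial sums\<close>

text \<open>
  The factor \<open>norm z\<close> makes the bound less than one throughout the open unit disc, for all \<open>s \<le> 1\<close>,
  and makes it tend to zero at the origin.
\<close>

lemma power_series_split_bound:
  fixes a :: "nat \<Rightarrow> complex"
  assumes a0: "a 0 = 1" and summ: "summable (\<lambda>n. norm (a (Suc n)))"
    and le: "(\<Sum>n. norm (a (Suc n))) \<le> s" and z: "norm z < 1"
  obtains P T where "(\<Sum>n. a n * z ^ (n + 1)) = z * (P + T)"
    and "z + (\<Sum>n=1..m. a n * z ^ (n + 1)) = z * P"
    and "norm (P - 1) + norm T \<le> norm z * s"
proof -
  define b where "b n = a (Suc n) * z ^ Suc n" for n
  have bb: "norm (b n) \<le> norm z * norm (a (Suc n))" for n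
  proof -
    have "norm z ^ n \<le> 1"
      using z by (intro power_le_one) auto
    then have "norm z * norm (a (Suc n)) * norm z ^ n \<le> norm z * norm (a (Suc n)) * 1"
      by (intro mult_left_mono) auto
    then show ?thesis
      by (simp add: b_def norm_mult norm_power mult_ac)
  qed
  have sz: "summable (\<lambda>n. norm z * norm (a (Suc n)))"
    using summ by (rule summable_mult)
  have snb: "summable (\<lambda>n. norm (b n))"
    by (rule summable_comparison_test'[OF sz, of 0]) (use bb in auto)
  then have sb: "summable b"
    by (rule summable_norm_cancel)
  define P where "P = 1 + (\<Sum>n<m. b n)"
  define T where "T = (\<Sum>n. b (n + m))"
  have split: "suminf b = T + (\<Sum>n<m. b n)"
    unfolding T_def by (rule suminf_split_initial_segment[OF sb])
  have "(\<lambda>n. a (Suc n) * z ^ Suc n) sums suminf b"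
    using sb unfolding b_def by (rule summable_sums)
  then have "(\<lambda>n. a n * z ^ n) sums (suminf b + 1)"
    by (subst (asm) sums_Suc_iff) (simp add: a0)
  then have "(\<lambda>n. z * (a n * z ^ n)) sums (z * (suminf b + 1))"
    by (rule sums_mult)
  then have 1: "(\<Sum>n. a n * z ^ (n + 1)) = z * (P + T)"
    using split by (auto simp: P_def sums_iff mult_ac add_ac)
  have "(\<Sum>n=1..m. a n * z ^ (n + 1)) = (\<Sum>n<m. a (Suc n) * z ^ (Suc n + 1))"
    by (rule sum.reindex_bij_witness[of _ Suc "\<lambda>n. n - 1"]) auto
  then have 2: "z + (\<Sum>n=1..m. a n * z ^ (n + 1)) = z * P"
    by (simp add: P_def b_def sum_distrib_left algebra_simps)
  have "norm T \<le> (\<Sum>n. norm (b (n + m)))"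
    unfolding T_def using snb by (intro summable_norm summable_ignore_initial_segment)
  moreover have "norm (P - 1) \<le> (\<Sum>n<m. norm (b n))"
    by (simp add: P_def norm_sum)
  moreover have "(\<Sum>n. norm (b n)) = (\<Sum>n. norm (b (n + m))) + (\<Sum>n<m. norm (b n))"
    by (rule suminf_split_initial_segment[OF snb])
  moreover have "(\<Sum>n. norm (b n)) \<le> (\<Sum>n. norm z * norm (a (Suc n)))"
    by (rule suminf_le[OF bb snb sz])
  moreover have "(\<Sum>n. norm z * norm (a (Suc n))) \<le> norm z * s"
    using le by (subst suminf_mult[OF summ]) (rule mult_left_mono, auto)
  ultimately have 3: "norm (P - 1) + norm T \<le> norm z * s"
    by linarith
  show ?thesis
    by (rule that[OF 1 2 3])
qed

lemma quotient_ext_at_zero: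
  assumes f: "\<And>w. norm w < 1 \<Longrightarrow> norm (F w - 1) \<le> norm w * s \<and> f w = w * F w"
    and g: "\<And>w. norm w < 1 \<Longrightarrow> norm (G w - 1) \<le> norm w * s \<and> g w = w * G w"
  shows "quotient_ext f g 0 = 1"
proof -
  have near: "eventually (\<lambda>w::complex. norm w < 1) (at 0)"
    using eventually_at_ball[of 1 "0::complex" UNIV] by (auto elim: eventually_mono)
  have to_one: "(H \<longlongrightarrow> 1) (at 0)"
    if H: "\<And>w. norm w < 1 \<Longrightarrow> norm (H w - 1) \<le> norm w * s" for H :: "complex \<Rightarrow> complex"
  proof (subst LIM_zero_iff[symmetric], rule Lim_null_comparison)
    show "eventually (\<lambda>w. norm (H w - 1) \<le> norm w * s) (at 0)"
      using near by eventually_elim (rule H)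
    show "((\<lambda>w::complex. norm w * s) \<longlongrightarrow> 0) (at 0)"
      by (auto intro!: tendsto_eq_intros)
  qed
  have "((\<lambda>w. F w / G w) \<longlongrightarrow> 1 / 1) (at 0)"
    by (intro tendsto_divide to_one) (use f g in auto)
  moreover have "eventually (\<lambda>w. F w / G w = f w / g w) (at 0)"
    using near eventually_neq_at_within[of 0 0 UNIV]
    by eventually_elim (use f g in auto)
  ultimately have "((\<lambda>w. f w / g w) \<longlongrightarrow> 1) (at 0)"
    by (auto intro: Lim_transform_eventually)
  then show ?thesis
    by (simp add: quotient_ext_def tendsto_Lim)
qed

theorem re_quotients_with_partial_sum:
  fixes a :: "nat \<Rightarrow> complex"
  defines "f \<equiv> \<lambda>z. \<Sum>n. a n * z ^ (n + 1)"
    and "g \<equiv> \<lambda>m z. z + (\<Sum>n=1..m. a n * z ^ (n + 1))"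
  assumes a0: "a 0 = 1" and summ: "summable (\<lambda>n. norm (a (Suc n)))"
    and le: "(\<Sum>n. norm (a (Suc n))) \<le> s" and s1: "s \<le> 1" and z: "norm z < 1"
  shows "1 - s \<le> Re (quotient_ext f (g m) z)"
    and "1 / (1 + s) \<le> Re (quotient_ext (g m) f z)"
proof -
  have s0: "0 \<le> s"
    using le suminf_nonneg[OF summ] by simp
  have "\<exists>P T. f w = w * (P + T) \<and> g m w = w * P \<and> norm (P - 1) + norm T \<le> norm w * s"
    if "norm w < 1" for w
    unfolding f_def g_def by (rule power_series_split_bound[OF a0 summ le that, of m]) blast
  then obtain P T where PT: "\<And>w. norm w < 1 \<Longrightarrow> f w = w * (P w + T w) \<and> g m w = w * P w
      \<and> norm (P w - 1) + norm (T w) \<le> norm w * s"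
    by metis
  have G: "norm (P w - 1) \<le> norm w * s \<and> g m w = w * P w" if "norm w < 1" for w
    using PT[OF that] norm_ge_zero[of "T w"] by linarith
  have F: "norm (P w + T w - 1) \<le> norm w * s \<and> f w = w * (P w + T w)" if "norm w < 1" for w
    using PT[OF that] norm_triangle_ineq[of "P w - 1" "T w"] by (simp add: algebra_simps)
  have "1 - s \<le> Re (quotient_ext f (g m) z) \<and> 1 / (1 + s) \<le> Re (quotient_ext (g m) f z)"
  proof (cases "z = 0")
    case True
    have "quotient_ext f (g m) 0 = 1" "quotient_ext (g m) f 0 = 1"
      using quotient_ext_at_zero[of "\<lambda>w. P w + T w" s f P "g m"]
        quotient_ext_at_zero[of P s "g m" "\<lambda>w. P w + T w" f] F G by blast+
    then show ?thesis
      using True s0 by simp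
  next
    case False
    have "norm z * s \<le> norm z" "norm z * s \<le> s"
      using s0 s1 z by (simp_all add: mult_left_le mult_left_le_one_le)
    then have "norm (P z - 1) < 1" "norm (P z + T z - 1) < 1"
      and sum_le: "norm (P z - 1) + norm (T z) \<le> s"
      using F[OF z] G[OF z] PT[OF z] z by linarith+
    then have P0: "P z \<noteq> 0" and PT0: "P z + T z \<noteq> 0"
      by auto
    define u where "u = T z / P z"
    have u: "norm u \<le> s"
      unfolding u_def by (rule norm_quotient_le_of_perturbation[OF sum_le s1 P0])
    have eq: "1 + u = (P z + T z) / P z"
      using P0 by (simp add: u_def field_simps)
    then have u1: "1 + u \<noteq> 0"
      using P0 PT0 by simp
    have "quotient_ext f (g m) z = 1 + u" "quotient_ext (g m) f z = 1 / (1 + u)"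
      using F[OF z] G[OF z] False eq by (simp_all add: quotient_ext_def)
    moreover have "1 - s \<le> Re (1 + u)"
      using u abs_Re_le_cmod[of u] by simp
    ultimately show ?thesis
      using Re_inverse_one_plus_ge[OF u s1 u1] by simp
  qed
  then show "1 - s \<le> Re (quotient_ext f (g m) z)" "1 / (1 + s) \<le> Re (quotient_ext (g m) f z)"
    by simp_all
qed

section \<open>Coefficients of the q-Bessel function\<close>

lemma q_pochhammer_0: "q_pochhammer a q 0 = 1"
  by (simp add: q_pochhammer_def)

lemma q_pochhammer_Suc: "q_pochhammer a q (Suc n) = q_pochhammer a q n * (1 - a * q ^ n)"
  by (simp add: q_pochhammer_def)

lemma bessel_coeff_0: "q > 0 \<Longrightarrow> bessel_coeff \<nu> q 0 = 1"
  by (simp add: bessel_coeff_def q_pochhammer_0)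

text \<open>
  The ratio is \<open>q\<^sup>\<nu> q\<^bsup>2n+1\<^esup> / (4 (1 - q\<^bsup>n+1\<^esup>) (1 - q\<^bsup>\<nu>+n+1\<^esup>))\<close> in absolute value. The estimate discards
  the power \<open>q\<^bsup>2n+1\<^esup>\<close> and replaces the two factors of the denominator by the lower bounds
  \<open>1 - q\<close> and \<open>1 - q\<^sup>\<nu>\<close>, so that it
  is uniform in \<open>n\<close> and yields a geometric majorant.
\<close>

lemma bessel_coeff_ratio:
  assumes q: "0 < q" "q < 1" and x1: "q powr \<nu> < 1"
  shows "\<bar>bessel_coeff \<nu> q (Suc n)\<bar>
      \<le> q powr \<nu> / (4 * (1 - q) * (1 - q powr \<nu>)) * \<bar>bessel_coeff \<nu> q n\<bar>"
proof -
  let ?x = "q powr \<nu>"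
  define A where "A = 1 - q * q ^ n"
  define B where "B = 1 - q powr (\<nu> + 1) * q ^ n"
  have x0: "0 < ?x"
    using q by simp
  have qn: "q ^ n \<le> 1"
    using q by (intro power_le_one) auto
  have qqn: "q * q ^ n \<le> q * 1"
    using qn q by (intro mult_left_mono) auto
  then have A: "1 - q \<le> A"
    by (simp add: A_def)
  have "?x * (q * q ^ n) \<le> ?x * 1"
    using order_trans[OF qqn] q by (intro mult_left_mono) auto
  then have B: "1 - ?x \<le> B"
    using q by (simp add: B_def powr_add mult_ac)
  have "bessel_coeff \<nu> q (Suc n)
      = - (?x * q powr real (2 * n + 1) / (4 * A * B)) * bessel_coeff \<nu> q n"
  proof -
    have "real (Suc n) * (real (Suc n) + \<nu>) = real n * (real n + \<nu>) + \<nu> + real (2 * n + 1)"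
      by (simp add: algebra_simps)
    then show ?thesis
      by (simp add: bessel_coeff_def q_pochhammer_Suc A_def B_def powr_add mult_ac)
  qed
  then have "\<bar>bessel_coeff \<nu> q (Suc n)\<bar>
      = ?x * q powr real (2 * n + 1) / (4 * A * B) * \<bar>bessel_coeff \<nu> q n\<bar>"
    using A B q x1 by (simp add: abs_mult)
  also have "\<dots> \<le> ?x / (4 * (1 - q) * (1 - ?x)) * \<bar>bessel_coeff \<nu> q n\<bar>"
  proof (intro mult_right_mono frac_le)
    have "q powr real (2 * n + 1) \<le> 1"
      using q by (intro powr_le1) auto
    then show "?x * q powr real (2 * n + 1) \<le> ?x"
      using x0 by (intro mult_left_le) auto
    show "4 * (1 - q) * (1 - ?x) \<le> 4 * A * B"
      using A B q x1 by (intro mult_mono) auto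
  qed (use q x1 in auto)
  finally show ?thesis .
qed

theorem theorem1:
  fixes \<nu> q :: real and m :: nat and z :: complex
  assumes "\<nu> > -1" and "0 < q" and "q < 1"
    and "2 * (1 - q) * (1 - q powr \<nu>) \<ge> q powr \<nu>"
    and "norm z < 1" and "m \<ge> 1"
  shows "Re (quotient_ext (normalized_bessel \<nu> q) (normalized_bessel_partial \<nu> q m) z)
           \<ge> (4 * (1 - q) * (1 - q powr \<nu>) - 2 * q powr \<nu>) /
             (4 * (1 - q) * (1 - q powr \<nu>) - q powr \<nu>) \<and>
         Re (quotient_ext (normalized_bessel_partial \<nu> q m) (normalized_bessel \<nu> q) z)
           \<ge> (4 * (1 - q) * (1 - q powr \<nu>) - q powr \<nu>) /
             (4 * (1 - q) * (1 - q powr \<nu>))"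
proof -
  define x where "x = q powr \<nu>"
  define D where "D = 4 * (1 - q) * (1 - x)"
  define r where "r = x / D"
  define s where "s = x / (D - x)"
  have x0: "0 < x"
    using assms(2) by (simp add: x_def)
  have xD: "2 * x \<le> D"
    using assms(4) by (simp add: D_def x_def algebra_simps)
  then have D0: "0 < D"
    using x0 by linarith
  then have x1: "x < 1"
    using assms(3) by (simp add: D_def zero_less_mult_iff)
  have r: "0 < r" "r < 1"
    using x0 xD D0 by (simp_all add: r_def)
  have s1: "s \<le> 1"
    using x0 xD by (simp add: s_def)
  have geo: "\<bar>bessel_coeff \<nu> q n\<bar> \<le> r ^ n" for n
  proof (induction n)
    case 0
    then show ?case
      using assms(2) by (simp add: bessel_coeff_0)
  next
    case (Suc n)
    have "\<bar>bessel_coeff \<nu> q (Suc n)\<bar> \<le> r * \<bar>bessel_coeff \<nu> q n\<bar>"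
      using bessel_coeff_ratio[OF assms(2,3), of \<nu> n] x1 by (simp add: r_def D_def x_def)
    also have "\<dots> \<le> r * r ^ n"
      using Suc r by (intro mult_left_mono) auto
    finally show ?case
      by simp
  qed
  define a :: "nat \<Rightarrow> complex" where "a n = of_real (bessel_coeff \<nu> q n)" for n
  have na: "norm (a (Suc n)) \<le> r * r ^ n" for n
    using geo[of "Suc n"] by (simp add: a_def)
  have "(\<lambda>n. r * r ^ n) sums (r * (1 / (1 - r)))"
    using r by (intro sums_mult geometric_sums) auto
  moreover have "r * (1 / (1 - r)) = s"
    using x0 xD D0 by (simp add: r_def s_def field_simps)
  ultimately have gs: "(\<lambda>n. r * r ^ n) sums s"
    by simp
  have summ: "summable (\<lambda>n. norm (a (Suc n)))"
    by (rule summable_comparison_test'[OF sums_summable[OF gs], of 0]) (use na in auto)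
  have le: "(\<Sum>n. norm (a (Suc n))) \<le> s"
    using suminf_le[OF na summ sums_summable[OF gs]] gs by (simp add: sums_iff)
  have a0: "a 0 = 1"
    using assms(2) by (simp add: a_def bessel_coeff_0)
  have f: "normalized_bessel \<nu> q = (\<lambda>z. \<Sum>n. a n * z ^ (n + 1))"
    and g: "normalized_bessel_partial \<nu> q m = (\<lambda>z. z + (\<Sum>n=1..m. a n * z ^ (n + 1)))"
    by (simp_all add: fun_eq_iff normalized_bessel_def normalized_bessel_partial_def a_def)
  have "(D - 2 * x) / (D - x) = 1 - s" "(D - x) / D = 1 / (1 + s)"
    using x0 xD D0 by (simp_all add: s_def field_simps)
  then show ?thesis
    using re_quotients_with_partial_sum[OF a0 summ le s1 assms(5), of m]
    unfolding f g D_def x_def by simp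
qed

end
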